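(* Let $\{X_t : t=0,1,2,\ldots\}$ be an irreducible and aperiodic discrete-time Markov chain with finite state space $\mathcal{S}$ and stationary distribution $\boldsymbol{\pi}=(\pi_j)_{j\in\mathcal{S}}$. For $j\in\mathcal{S}$ let $T_j=\inf\{t\ge 1 : X_t=j\}$. Then the sum $\sum_{j\in\mathcal{S}}\pi_j\,\mathrm{E}_i[T_j]$ is independent of $i\in\mathcal{S}$.
   Context: $\mathrm{E}_i[\cdot]$ denotes conditional expectation given $X_0=i$. The Markov chain is time-homogeneous with transition matrix $P$; its stationary distribution is the unique probability vector $\boldsymbol{\pi}$ with $\sum_{i}\pi_iP_{ij}=\pi_j$ for all $j\in\mathcal{S}$. *)

theory Defs
  imports "HOL-Probability.Probability"
begin

text \<open>A matrix \<open>P :: real^'s^'s\<close> is read as \<open>P $ i $ j = P\<^sub>i\<^sub>j\<close>, the probability of moving from \<open>i\<close> to \<open>j\<close>.\<close>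

definition stochastic_matrix :: "real^'s::finite^'s \<Rightarrow> bool" where
  "stochastic_matrix P \<longleftrightarrow> (\<forall>i j. 0 \<le> P $ i $ j) \<and> (\<forall>i. (\<Sum>j\<in>UNIV. P $ i $ j) = 1)"

text \<open>Needed because \<open>^\<close> on \<open>real^'s^'s\<close> would not be the matrix power.\<close>

primrec matrix_power :: "real^'s::finite^'s \<Rightarrow> nat \<Rightarrow> real^'s^'s" where
  "matrix_power P 0 = mat 1"
| "matrix_power P (Suc n) = P ** matrix_power P n"

definition irreducible_chain :: "real^'s::finite^'s \<Rightarrow> bool" where
  "irreducible_chain P \<longleftrightarrow> (\<forall>i j. \<exists>n. 0 < matrix_power P n $ i $ j)"

definition aperiodic_chain :: "real^'s::finite^'s \<Rightarrow> bool" where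
  "aperiodic_chain P \<longleftrightarrow> (\<forall>i. Gcd {n. 1 \<le> n \<and> 0 < matrix_power P n $ i $ i} = 1)"

definition stationary_distribution :: "real^'s::finite^'s \<Rightarrow> real^'s \<Rightarrow> bool" where
  "stationary_distribution P \<pi> \<longleftrightarrow>
     (\<forall>i. 0 \<le> \<pi> $ i) \<and> (\<Sum>i\<in>UNIV. \<pi> $ i) = 1 \<and>
     (\<forall>j. (\<Sum>i\<in>UNIV. \<pi> $ i * P $ i $ j) = \<pi> $ j)"

text \<open>Time-homogeneous Markov chain with transition matrix \<open>P\<close> and arbitrary initial distribution;
  the conditional probability is prescribed only for histories of positive probability.\<close>

locale markov_chain = prob_space M
  for M :: "'a measure" and X :: "nat \<Rightarrow> 'a \<Rightarrow> 's::finite" and P :: "real^'s^'s" +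
  assumes stochastic: "stochastic_matrix P"
    and measurable_chain: "\<And>t. X t \<in> measurable M (count_space UNIV)"
    and markov: "\<And>n (x :: nat \<Rightarrow> 's) j.
      0 < \<P>(\<omega> in M. \<forall>t\<le>n. X t \<omega> = x t) \<Longrightarrow>
      \<P>(\<omega> in M. X (Suc n) \<omega> = j \<bar> \<forall>t\<le>n. X t \<omega> = x t) = P $ x n $ j"

text \<open>\<open>T\<^sub>j = inf {t \<ge> 1. X\<^sub>t = j}\<close>, equal to \<open>\<infinity>\<close> if \<open>j\<close> is never visited at a positive time.\<close>

definition return_time :: "(nat \<Rightarrow> 'a \<Rightarrow> 's) \<Rightarrow> 's \<Rightarrow> 'a \<Rightarrow> enat" where
  "return_time X j \<omega> = Inf {enat t |t. 1 \<le> t \<and> X t \<omega> = j}"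

text \<open>Conditional expectation, with values in \<open>[0, \<infinity>]\<close>, given the event \<open>X\<^sub>0 = i\<close>: on an event of
  positive probability, \<^const>\<open>uniform_measure\<close> is the conditional probability measure
  \<open>A \<mapsto> M(A \<inter> {X\<^sub>0 = i}) / M{X\<^sub>0 = i}\<close>.\<close>

definition expectation_from ::
  "'a measure \<Rightarrow> (nat \<Rightarrow> 'a \<Rightarrow> 's) \<Rightarrow> 's \<Rightarrow> ('a \<Rightarrow> ennreal) \<Rightarrow> ennreal" where
  "expectation_from M X i f = (\<integral>\<^sup>+ \<omega>. f \<omega> \<partial>uniform_measure M {\<omega> \<in> space M. X 0 \<omega> = i})"

text \<open>Conditioning on \<open>X\<^sub>0 = i\<close> requires \<open>i\<close> to have positive initial probability, which no single
  initial distribution has to grant for all \<open>i\<close> at once (for instance when the chain starts at a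
  fixed state). Hence the usual family of laws: under each \<open>M i\<close> the process \<open>X\<close> is a chain with the
  same \<open>P\<close>, and \<open>X\<^sub>0 = i\<close> has positive probability. A constant family (one initial distribution of
  full support) and the laws of the chain started at \<open>i\<close> are both instances.\<close>

definition markov_family ::
  "('s::finite \<Rightarrow> 'a measure) \<Rightarrow> (nat \<Rightarrow> 'a \<Rightarrow> 's) \<Rightarrow> real^'s^'s \<Rightarrow> bool" where
  "markov_family M X P \<longleftrightarrow>
     (\<forall>i. markov_chain (M i) X P \<and> 0 < \<P>(\<omega> in M i. X 0 \<omega> = i))"

end

theory Submission
  imports Defs
begin

text \<open>Write \<open>m i j = E\<^sub>i[T\<^sub>j]\<close>. First-step analysis gives \<open>m i j = 1 + (\<Sum>k\<noteq>j. P\<^sub>i\<^sub>k m k j)\<close>; averaging it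
  against \<open>\<pi>\<close> gives Kac's formula \<open>\<pi>\<^sub>j m j j = 1\<close>. Hence \<open>F i = (\<Sum>j. \<pi>\<^sub>j m i j)\<close> satisfies
  \<open>F i = 1 + (P F) i - (\<Sum>j. P\<^sub>i\<^sub>j) = (P F) i\<close>, and a harmonic function of an irreducible finite chain
  is constant by the maximum principle. Finiteness of \<open>m\<close> comes from the truncated form of Kac's
  argument, which bounds the partial sums of \<open>\<pi>\<^sub>j (\<Sum>n. P\<^sub>j(T\<^sub>j > n))\<close> by \<open>1\<close>.\<close>

section \<open>Avoidance probabilities and mean return times\<close>

text \<open>This is \<open>P\<^sub>i(T\<^sub>j > n)\<close>, computed from the matrix alone by
  conditioning on the first step. Only times 1 to \<open>n\<close> are restricted, so the start
  \<open>i = j\<close> is allowed.\<close>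

primrec avoid_prob :: "real^'s::finite^'s \<Rightarrow> 's \<Rightarrow> nat \<Rightarrow> 's \<Rightarrow> real" where
  "avoid_prob P j 0 i = 1"
| "avoid_prob P j (Suc n) i = (\<Sum>k\<in>UNIV - {j}. P $ i $ k * avoid_prob P j n k)"

text \<open>The tail-sum formula for \<open>E\<^sub>i[T\<^sub>j]\<close>. Being real-valued, it is
  meaningful only once the series is known to be summable.\<close>

definition mean_return :: "real^'s::finite^'s \<Rightarrow> 's \<Rightarrow> 's \<Rightarrow> real" where
  "mean_return P i j = (\<Sum>n. avoid_prob P j n i)"

lemma avoid_prob_nonneg:
  assumes "stochastic_matrix P"
  shows "0 \<le> avoid_prob P j n i"
  using assms by (induction n arbitrary: i) (auto simp: stochastic_matrix_def intro!: sum_nonneg)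

section \<open>Irreducibility, positivity of \<pi> and the maximum principle\<close>

lemma matrix_power_pos_imp:
  assumes P: "stochastic_matrix P"
    and step: "\<And>i j. Q i \<Longrightarrow> 0 < P $ i $ j \<Longrightarrow> Q j"
    and "Q i" "0 < matrix_power P n $ i $ j"
  shows "Q j"
  using assms(3,4)
proof (induction n arbitrary: i)
  case 0
  then show ?case by (auto simp: mat_def split: if_splits)
next
  case (Suc n)
  have "0 < (\<Sum>k\<in>UNIV. P $ i $ k * matrix_power P n $ k $ j)"
    using Suc.prems by (simp add: matrix_matrix_mult_def)
  then obtain k where "0 < P $ i $ k * matrix_power P n $ k $ j"
    by (metis (no_types, lifting) not_less sum_nonpos)
  moreover have "0 \<le> P $ i $ k"
    using P by (simp add: stochastic_matrix_def)
  ultimately have "0 < P $ i $ k" "0 < matrix_power P n $ k $ j"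
    by (auto simp: zero_less_mult_iff)
  with Suc.IH step Suc.prems show ?case by blast
qed

text \<open>A positive entry of a matrix power comes from a path of positive transitions, and
  \<open>Q\<close> is carried along it. This is the form in which irreducibility is used: for
  positivity of \<pi>, for the maximum principle and for summability.\<close>

lemma irreducible_chain_propagate:
  assumes "stochastic_matrix P" "irreducible_chain P"
    and "\<And>i j. Q i \<Longrightarrow> 0 < P $ i $ j \<Longrightarrow> Q j"
    and "Q i"
  shows "Q j"
  using assms matrix_power_pos_imp[of P Q i _ j] unfolding irreducible_chain_def by blast

text \<open>Total mass 1 forces some state to have positive mass, and stationarity passes positive
  mass on along each positive transition.\<close>

lemma stationary_pos:
  assumes P: "stochastic_matrix P" and irr: "irreducible_chain P"
    and st: "stationary_distribution P \<pi>"
  shows "0 < \<pi> $ j"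
proof -
  have nonneg: "0 \<le> \<pi> $ i" "0 \<le> P $ i $ j" for i j
    using P st by (auto simp: stochastic_matrix_def stationary_distribution_def)
  have "0 < (\<Sum>i\<in>UNIV. \<pi> $ i)"
    using st by (simp add: stationary_distribution_def)
  then obtain i where i: "0 < \<pi> $ i"
    by (metis not_less sum_nonpos)
  show ?thesis
  proof (rule irreducible_chain_propagate[OF P irr, where Q = "\<lambda>j. 0 < \<pi> $ j"])
    fix k l assume "0 < \<pi> $ k" "0 < P $ k $ l"
    then have "0 < \<pi> $ k * P $ k $ l" by simp
    also have "\<dots> \<le> (\<Sum>i\<in>UNIV. \<pi> $ i * P $ i $ l)"
      by (rule member_le_sum) (auto simp: nonneg)
    also have "\<dots> = \<pi> $ l"
      using st by (simp add: stationary_distribution_def)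
    finally show "0 < \<pi> $ l" .
  qed (rule i)
qed

text \<open>Maximum principle: at a maximiser the average of the nonnegative deficits
  \<open>m - F l\<close> is zero, so every state reachable in one step is a maximiser too.\<close>

lemma harmonic_const:
  fixes F :: "'s::finite \<Rightarrow> real"
  assumes P: "stochastic_matrix P" and irr: "irreducible_chain P"
    and harm: "\<And>i. F i = (\<Sum>k\<in>UNIV. P $ i $ k * F k)"
  shows "F i = F i'"
proof -
  define m where "m = Max (range F)"
  have le: "F k \<le> m" for k
    by (simp add: m_def)
  have "m \<in> range F"
    unfolding m_def by (rule Max_in) auto
  then obtain i0 where i0: "F i0 = m"
    by auto
  have "F j = m" for j
  proof (rule irreducible_chain_propagate[OF P irr, where Q = "\<lambda>j. F j = m"])
    fix k l assume k: "F k = m" and kl: "0 < P $ k $ l"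
    have "(\<Sum>l\<in>UNIV. P $ k $ l * (m - F l)) = m * (\<Sum>l\<in>UNIV. P $ k $ l) - F k"
      by (subst harm) (simp add: algebra_simps sum_subtractf sum_distrib_left)
    also have "\<dots> = 0"
      using P k by (simp add: stochastic_matrix_def)
    finally have "\<forall>l\<in>UNIV. P $ k $ l * (m - F l) = 0"
      using P le by (subst (asm) sum_nonneg_eq_0_iff) (auto simp: stochastic_matrix_def)
    with kl show "F l = m" by force
  qed (rule i0)
  then show ?thesis by simp
qed

section \<open>Finiteness of mean return times and Kac's formula\<close>

lemma stationary_weighted_sum:
  assumes "stationary_distribution P \<pi>"
  shows "(\<Sum>i\<in>UNIV. \<pi> $ i * (\<Sum>k\<in>A. P $ i $ k * f k)) = (\<Sum>k\<in>A. \<pi> $ k * f k)"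
proof -
  have "(\<Sum>i\<in>UNIV. \<pi> $ i * (\<Sum>k\<in>A. P $ i $ k * f k))
      = (\<Sum>k\<in>A. (\<Sum>i\<in>UNIV. \<pi> $ i * P $ i $ k) * f k)"
    by (simp add: sum_distrib_left sum_distrib_right mult.assoc) (rule sum.swap)
  with assms show ?thesis
    by (simp add: stationary_distribution_def)
qed

text \<open>Averaging the first-step recursion of the partial sums \<open>S\<close> against \<pi>
  relates level \<open>Suc N\<close> to level \<open>N\<close>. Since \<open>S\<close> increases in
  \<open>N\<close>, the right side may be raised to level \<open>Suc N\<close>; then all terms
  except the one at \<open>j\<close> cancel, which is legitimate because finite sums are real
  numbers.\<close>

lemma avoid_prob_partial_sum_le:
  assumes P: "stochastic_matrix P" and st: "stationary_distribution P \<pi>"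
  shows "\<pi> $ j * (\<Sum>n<N. avoid_prob P j n j) \<le> 1"
proof -
  define S where "S N i = (\<Sum>n<N. avoid_prob P j n i)" for N i
  have mono: "S N i \<le> S (Suc N) i" for i
    by (simp add: S_def avoid_prob_nonneg[OF P])
  have nonneg: "0 \<le> \<pi> $ i" and total: "(\<Sum>i\<in>UNIV. \<pi> $ i) = 1" for i
    using st by (auto simp: stationary_distribution_def)
  have step: "S (Suc N) i = 1 + (\<Sum>k\<in>UNIV - {j}. P $ i $ k * S N k)" for i
    unfolding S_def sum.lessThan_Suc_shift
    by (simp add: sum_distrib_left) (rule sum.swap)
  have "(\<Sum>i\<in>UNIV. \<pi> $ i * S (Suc N) i) = 1 + (\<Sum>k\<in>UNIV - {j}. \<pi> $ k * S N k)"
    unfolding step distrib_left sum.distrib stationary_weighted_sum[OF st] by (simp add: total)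
  also have "\<dots> \<le> 1 + (\<Sum>k\<in>UNIV - {j}. \<pi> $ k * S (Suc N) k)"
    by (intro add_left_mono sum_mono mult_left_mono mono nonneg)
  finally have "\<pi> $ j * S (Suc N) j \<le> 1"
    by (subst (asm) sum.remove[of UNIV j]) auto
  moreover have "\<pi> $ j * S N j \<le> \<pi> $ j * S (Suc N) j"
    by (intro mult_left_mono mono nonneg)
  ultimately show ?thesis
    by (simp add: S_def)
qed

text \<open>At the start \<open>j\<close> the truncated Kac bound, divided by
  \<open>\<pi> $ j > 0\<close>, bounds the partial sums. Summability then spreads from
  \<open>j\<close> to all states.\<close>

lemma summable_avoid_prob:
  assumes P: "stochastic_matrix P" and irr: "irreducible_chain P"
    and st: "stationary_distribution P \<pi>"
  shows "summable (\<lambda>n. avoid_prob P j n i)"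
proof (rule irreducible_chain_propagate[OF P irr, where Q = "\<lambda>i. summable (\<lambda>n. avoid_prob P j n i)"])
  show base: "summable (\<lambda>n. avoid_prob P j n j)"
  proof (rule summableI_nonneg_bounded)
    fix N
    show "(\<Sum>n<N. avoid_prob P j n j) \<le> 1 / \<pi> $ j"
      using avoid_prob_partial_sum_le[OF P st, of j N] stationary_pos[OF P irr st, of j]
      by (simp add: field_simps)
  qed (rule avoid_prob_nonneg[OF P])
  fix k l assume k: "summable (\<lambda>n. avoid_prob P j n k)" and kl: "0 < P $ k $ l"
  show "summable (\<lambda>n. avoid_prob P j n l)"
  \<comment> \<open>For \<open>l \<noteq> j\<close> the term of \<open>l\<close> occurs in the
    recursion for \<open>k\<close>, so the series at \<open>l\<close> is dominated by the shifted
    series at \<open>k\<close>. The recursion omits \<open>j\<close> itself, where the base case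
    applies.\<close>
  proof (cases "l = j")
    case False
    have "summable (\<lambda>n. P $ k $ l * avoid_prob P j n l)"
    proof (rule summable_comparison_test')
      show "summable (\<lambda>n. avoid_prob P j (Suc n) k)"
        using k by (subst summable_Suc_iff)
      fix n
      have "P $ k $ l * avoid_prob P j n l \<le> avoid_prob P j (Suc n) k"
        unfolding avoid_prob.simps
        by (rule member_le_sum[where f = "\<lambda>l. P $ k $ l * avoid_prob P j n l"])
          (use False P in \<open>auto simp: avoid_prob_nonneg stochastic_matrix_def\<close>)
      then show "norm (P $ k $ l * avoid_prob P j n l) \<le> avoid_prob P j (Suc n) k"
        using kl avoid_prob_nonneg[OF P, of j n l] by simp
    qed
    then show ?thesis
      using kl by (subst (asm) summable_cmult_iff) auto
  qed (use base in simp)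
qed

lemma mean_return_first_step:
  assumes "stochastic_matrix P" "irreducible_chain P" "stationary_distribution P \<pi>"
  shows "mean_return P i j = 1 + (\<Sum>k\<in>UNIV - {j}. P $ i $ k * mean_return P k j)"
proof -
  note summ = summable_avoid_prob[OF assms]
  have "mean_return P i j = 1 + (\<Sum>n. avoid_prob P j (Suc n) i)"
    unfolding mean_return_def using suminf_split_head[OF summ[of j i]] by simp
  also have "(\<Sum>n. avoid_prob P j (Suc n) i)
      = (\<Sum>k\<in>UNIV - {j}. \<Sum>n. P $ i $ k * avoid_prob P j n k)"
    unfolding avoid_prob.simps by (rule suminf_sum) (intro summable_mult summ)
  also have "\<dots> = (\<Sum>k\<in>UNIV - {j}. P $ i $ k * mean_return P k j)"
    unfolding mean_return_def by (intro sum.cong refl suminf_mult summ)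
  finally show ?thesis .
qed

text \<open>In the averaged first-step equation the terms with \<open>k \<noteq> j\<close> occur on
  both sides; they are real numbers and cancel.\<close>

lemma kac_formula:
  assumes "stochastic_matrix P" "irreducible_chain P" and st: "stationary_distribution P \<pi>"
  shows "\<pi> $ j * mean_return P j j = 1"
proof -
  have total: "(\<Sum>i\<in>UNIV. \<pi> $ i) = 1"
    using st by (simp add: stationary_distribution_def)
  have "(\<Sum>i\<in>UNIV. \<pi> $ i * mean_return P i j)
      = (\<Sum>i\<in>UNIV. \<pi> $ i * (1 + (\<Sum>k\<in>UNIV - {j}. P $ i $ k * mean_return P k j)))"
    by (simp only: mean_return_first_step[OF assms, of _ j, symmetric])
  also have "\<dots> = 1 + (\<Sum>k\<in>UNIV - {j}. \<pi> $ k * mean_return P k j)"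
    unfolding distrib_left sum.distrib stationary_weighted_sum[OF st] by (simp add: total)
  finally show ?thesis
    by (subst (asm) sum.remove[of UNIV j]) auto
qed

lemma weighted_mean_return_const:
  assumes P: "stochastic_matrix P" and irr: "irreducible_chain P"
    and st: "stationary_distribution P \<pi>"
  shows "(\<Sum>j\<in>UNIV. \<pi> $ j * mean_return P i j) = (\<Sum>j\<in>UNIV. \<pi> $ j * mean_return P i' j)"
proof (rule harmonic_const[OF P irr])
  fix i
  have total: "(\<Sum>j\<in>UNIV. \<pi> $ j) = 1" "(\<Sum>j\<in>UNIV. P $ i $ j) = 1"
    using P st by (auto simp: stationary_distribution_def stochastic_matrix_def)
  \<comment> \<open>Extending the first-step sum to \<open>k = j\<close> adds
    \<open>P $ i $ j * mean_return P j j\<close>, which has to be subtracted again; by Kac's formula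
    its multiple by \<open>\<pi> $ j\<close> is just \<open>P $ i $ j\<close>.\<close>
  have "\<pi> $ j * mean_return P i j
      = \<pi> $ j + (\<Sum>k\<in>UNIV. P $ i $ k * (\<pi> $ j * mean_return P k j)) - P $ i $ j" for j
  proof -
    have "mean_return P i j
        = 1 + (\<Sum>k\<in>UNIV. P $ i $ k * mean_return P k j) - P $ i $ j * mean_return P j j"
      using mean_return_first_step[OF assms, of i j] by (subst sum.remove[of UNIV j]) auto
    then have "\<pi> $ j * mean_return P i j = \<pi> $ j
        + (\<Sum>k\<in>UNIV. P $ i $ k * (\<pi> $ j * mean_return P k j))
        - P $ i $ j * (\<pi> $ j * mean_return P j j)"
      by (simp add: right_diff_distrib distrib_left sum_distrib_left mult.left_commute)
    then show ?thesis
      by (simp add: kac_formula[OF assms])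
  qed
  then have "(\<Sum>j\<in>UNIV. \<pi> $ j * mean_return P i j)
      = (\<Sum>j\<in>UNIV. \<Sum>k\<in>UNIV. P $ i $ k * (\<pi> $ j * mean_return P k j))"
    by (simp add: sum.distrib sum_subtractf total)
  also have "\<dots> = (\<Sum>k\<in>UNIV. P $ i $ k * (\<Sum>j\<in>UNIV. \<pi> $ j * mean_return P k j))"
    by (simp add: sum_distrib_left) (rule sum.swap)
  finally show "(\<Sum>j\<in>UNIV. \<pi> $ j * mean_return P i j)
      = (\<Sum>k\<in>UNIV. P $ i $ k * (\<Sum>j\<in>UNIV. \<pi> $ j * mean_return P k j))" .
qed

section \<open>The law of the return time of the process\<close>

lemma enat_less_return_time_iff:
  "enat n < return_time X j \<omega> \<longleftrightarrow> (\<forall>t\<in>{1..n}. X t \<omega> \<noteq> j)"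
proof -
  have "return_time X j \<omega> \<le> enat n \<longleftrightarrow> (\<exists>t\<in>{1..n}. X t \<omega> = j)"
  proof
    assume le: "return_time X j \<omega> \<le> enat n"
    \<comment> \<open>The infimum of the empty set is \<open>\<infinity>\<close>, which no
      \<open>enat n\<close> bounds; over a nonempty set the infimum is attained.\<close>
    then have "{enat t |t. 1 \<le> t \<and> X t \<omega> = j} \<noteq> {}"
      by (auto simp: return_time_def top_enat_def simp del: Collect_empty_eq)
    then have "return_time X j \<omega> \<in> {enat t |t. 1 \<le> t \<and> X t \<omega> = j}"
      unfolding return_time_def by (metis (no_types, lifting) Inf_enat_def LeastI_ex ex_in_conv)
    with le show "\<exists>t\<in>{1..n}. X t \<omega> = j"
      by auto
  next
    assume "\<exists>t\<in>{1..n}. X t \<omega> = j"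
    then show "return_time X j \<omega> \<le> enat n"
      unfolding return_time_def by (auto intro!: Inf_lower2)
  qed
  then show ?thesis
    by (simp flip: not_le)
qed

context markov_chain
begin

lemma measurable_X [measurable]: "X t \<in> measurable M (count_space UNIV)"
  by (rule measurable_chain)

text \<open>The Markov property multiplied out, so that it also covers histories of probability
  zero, where both sides vanish.\<close>

lemma prob_history_step:
  "\<P>(\<omega> in M. (\<forall>t\<le>m. X t \<omega> = x t) \<and> X (Suc m) \<omega> = k)
    = \<P>(\<omega> in M. \<forall>t\<le>m. X t \<omega> = x t) * P $ x m $ k"
proof (cases "0 < \<P>(\<omega> in M. \<forall>t\<le>m. X t \<omega> = x t)")
  case True
  then show ?thesis
    using markov[OF True, of k] by (simp add: cond_prob_def field_simps conj_commute)
next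
  case False
  then have zero: "\<P>(\<omega> in M. \<forall>t\<le>m. X t \<omega> = x t) = 0"
    by (simp add: zero_less_measure_iff)
  have "\<P>(\<omega> in M. (\<forall>t\<le>m. X t \<omega> = x t) \<and> X (Suc m) \<omega> = k) \<le> \<P>(\<omega> in M. \<forall>t\<le>m. X t \<omega> = x t)"
    by (rule finite_measure_mono) auto
  with zero show ?thesis
    by (simp add: measure_le_0_iff)
qed

text \<open>Induction on \<open>n\<close>, splitting by the next state \<open>k \<noteq> j\<close>,
  which is appended to the history. The Markov property conditions on whole histories, hence the
  arbitrary \<open>m\<close> and \<open>x\<close>.\<close>

lemma prob_history_avoid:
  "\<P>(\<omega> in M. (\<forall>t\<le>m. X t \<omega> = x t) \<and> (\<forall>t\<in>{Suc m..m + n}. X t \<omega> \<noteq> j))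
    = \<P>(\<omega> in M. \<forall>t\<le>m. X t \<omega> = x t) * avoid_prob P j n (x m)"
proof (induction n arbitrary: m x)
  case 0
  then show ?case by simp
next
  case (Suc n)
  let ?E = "\<lambda>k. {\<omega> \<in> space M. (\<forall>t\<le>Suc m. X t \<omega> = (x(Suc m := k)) t)
    \<and> (\<forall>t\<in>{Suc (Suc m)..Suc m + n}. X t \<omega> \<noteq> j)}"
  have hist: "(\<forall>t\<le>Suc m. X t \<omega> = (x(Suc m := k)) t) \<longleftrightarrow> (\<forall>t\<le>m. X t \<omega> = x t) \<and> X (Suc m) \<omega> = k"
    for \<omega> k
    by (auto simp: le_Suc_eq)
  have interval: "{Suc m..m + Suc n} = insert (Suc m) {Suc (Suc m)..Suc m + n}"
    by auto
  have split: "(\<forall>t\<in>{Suc m..m + Suc n}. X t \<omega> \<noteq> j)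
      \<longleftrightarrow> X (Suc m) \<omega> \<noteq> j \<and> (\<forall>t\<in>{Suc (Suc m)..Suc m + n}. X t \<omega> \<noteq> j)" for \<omega>
    unfolding interval by simp
  have "{\<omega> \<in> space M. (\<forall>t\<le>m. X t \<omega> = x t) \<and> (\<forall>t\<in>{Suc m..m + Suc n}. X t \<omega> \<noteq> j)}
      = (\<Union>k\<in>UNIV - {j}. ?E k)"
    unfolding split hist by auto
  then have "\<P>(\<omega> in M. (\<forall>t\<le>m. X t \<omega> = x t) \<and> (\<forall>t\<in>{Suc m..m + Suc n}. X t \<omega> \<noteq> j))
      = prob (\<Union>k\<in>UNIV - {j}. ?E k)"
    by simp
  also have "\<dots> = (\<Sum>k\<in>UNIV - {j}. prob (?E k))"
    unfolding hist by (rule finite_measure_finite_Union) (auto simp: disjoint_family_on_def)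
  also have "\<dots> = (\<Sum>k\<in>UNIV - {j}. \<P>(\<omega> in M. \<forall>t\<le>m. X t \<omega> = x t) * P $ x m $ k * avoid_prob P j n k)"
    unfolding Suc.IH unfolding hist prob_history_step by simp
  finally show ?case
    by (simp add: sum_distrib_left mult.assoc)
qed

lemma measurable_return_time [measurable]: "return_time X j \<in> measurable M (count_space UNIV)"
proof -
  \<comment> \<open>As a countable infimum over a fixed index set, with \<open>\<infinity>\<close>
    at times when \<open>j\<close> is not visited, the return time is measurable.\<close>
  have "(\<lambda>\<omega>. INF t\<in>{1..}. if X t \<omega> = j then enat t else \<infinity>) \<in> measurable M (count_space UNIV)"
    by measurable
  moreover have "return_time X j \<omega> = (INF t\<in>{1..}. if X t \<omega> = j then enat t else \<infinity>)" for \<omega>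
    unfolding return_time_def
    by (rule antisym) (auto intro!: INF_greatest Inf_greatest intro: Inf_lower INF_lower2)
  ultimately show ?thesis
    by (simp cong: measurable_cong)
qed

text \<open>The expectation of an \<open>enat\<close>-valued variable is the sum of its tail
  probabilities, and these are the avoidance probabilities.\<close>

lemma expectation_from_return_time:
  assumes pos: "0 < \<P>(\<omega> in M. X 0 \<omega> = i)"
    and summ: "summable (\<lambda>n. avoid_prob P j n i)"
  shows "expectation_from M X i (\<lambda>\<omega>. ennreal_of_enat (return_time X j \<omega>))
    = ennreal (mean_return P i j)"
proof -
  let ?A = "{\<omega> \<in> space M. X 0 \<omega> = i}"
  let ?U = "uniform_measure M ?A"
  have tail: "emeasure ?U {\<omega> \<in> space ?U. enat n < return_time X j \<omega>} = ennreal (avoid_prob P j n i)" for n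
  proof -
    have "emeasure ?U {\<omega> \<in> space ?U. enat n < return_time X j \<omega>}
        = emeasure M (?A \<inter> {\<omega> \<in> space M. enat n < return_time X j \<omega>}) / emeasure M ?A"
      by simp
    \<comment> \<open>The start \<open>X 0 \<omega> = i\<close> is viewed as a history with
      \<open>m = 0\<close>.\<close>
    also have "?A \<inter> {\<omega> \<in> space M. enat n < return_time X j \<omega>}
        = {\<omega> \<in> space M. (\<forall>t\<le>0. X t \<omega> = i) \<and> (\<forall>t\<in>{Suc 0..0 + n}. X t \<omega> \<noteq> j)}"
      by (auto simp: enat_less_return_time_iff)
    also have "emeasure M \<dots> = ennreal (prob ?A * avoid_prob P j n i)"
      unfolding emeasure_eq_measure prob_history_avoid[of 0 "\<lambda>_. i"] by simp
    also have "\<dots> / emeasure M ?A = ennreal (avoid_prob P j n i)"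
      using pos avoid_prob_nonneg[OF stochastic]
      by (simp add: emeasure_eq_measure divide_ennreal)
    finally show ?thesis .
  qed
  have "return_time X j \<in> measurable ?U (count_space UNIV)"
    by simp
  then have "expectation_from M X i (\<lambda>\<omega>. ennreal_of_enat (return_time X j \<omega>))
      = (\<Sum>n. emeasure ?U {\<omega> \<in> space ?U. enat n < return_time X j \<omega>})"
    unfolding expectation_from_def by (rule nn_integral_enat_function)
  also have "\<dots> = (\<Sum>n. ennreal (avoid_prob P j n i))"
    by (simp only: tail)
  also have "\<dots> = ennreal (mean_return P i j)"
    unfolding mean_return_def by (rule suminf_ennreal2[OF avoid_prob_nonneg[OF stochastic] summ])
  finally show ?thesis .
qed

end

theorem theorem3p2:
  fixes P :: "real^'s::finite^'s" and \<pi> :: "real^'s"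
    and M :: "'s \<Rightarrow> 'a measure" and X :: "nat \<Rightarrow> 'a \<Rightarrow> 's"
  assumes "markov_family M X P"
    and "irreducible_chain P"
    and "aperiodic_chain P"
    and "stationary_distribution P \<pi>"
  shows "\<forall>i i'.
    (\<Sum>j\<in>UNIV. ennreal (\<pi> $ j) *
       expectation_from (M i) X i (\<lambda>\<omega>. ennreal_of_enat (return_time X j \<omega>))) =
    (\<Sum>j\<in>UNIV. ennreal (\<pi> $ j) *
       expectation_from (M i') X i' (\<lambda>\<omega>. ennreal_of_enat (return_time X j \<omega>)))"
proof -
  have chain: "markov_chain (M i) X P" and pos: "0 < \<P>(\<omega> in M i. X 0 \<omega> = i)" for i
    using assms(1) by (auto simp: markov_family_def)
  have P: "stochastic_matrix P"
    using chain by (rule markov_chain.stochastic)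
  note summ = summable_avoid_prob[OF P assms(2,4)]
  have nonneg: "0 \<le> \<pi> $ j" "0 \<le> mean_return P i j" for i j
    using assms(4) unfolding mean_return_def
    by (auto simp: stationary_distribution_def intro!: suminf_nonneg summ avoid_prob_nonneg[OF P])
  \<comment> \<open>All factors are finite and nonnegative, so the sum in
    \<open>[0, \<infinity>]\<close> is a real sum that depends only on \<open>P\<close>, \<pi> and
    \<open>i\<close>, and no longer on the law \<open>M i\<close>.\<close>
  have "(\<Sum>j\<in>UNIV. ennreal (\<pi> $ j) *
       expectation_from (M i) X i (\<lambda>\<omega>. ennreal_of_enat (return_time X j \<omega>)))
      = ennreal (\<Sum>j\<in>UNIV. \<pi> $ j * mean_return P i j)" for i
    by (simp add: markov_chain.expectation_from_return_time[OF chain pos summ] nonneg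
        flip: ennreal_mult)
  then show ?thesis
    using weighted_mean_return_const[OF P assms(2,4)] by metis
qed

end
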